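(* Let $k\ge 1$ and $n\ge 0$ be integers and write $N=(k+1)n+r$ with $0\le r\le k$. Then for $c$ an indeterminate, \[ \det_{0\leq i,j \leq N-1}\big(\mathrm{Cat}_{i+j+2,k}^{(0,c)}\big)= \begin{cases} (-1)^{\binom{k+1}{2}n} \left(\frac{F_{(k+1)(n+1)}(c)}{F_{k+1}(c)}\right)^2, & \text{if } r=0,\\[6pt] (-1)^{\binom{k+1}{2}n + \binom{k-1}{2}} \left(\frac{F_{(k+1)(n+1)}(c)}{F_{k+1}(c)}\right)^2, & \text{if } r=k-1,\\[6pt] (-1)^{\binom{k+1}{2}n + \binom{k}{2}}(k+1) F_{k+1}(c) \sum\limits_{j=1}^{n+1} \left(\frac{F_{(k+1)j}(c)}{F_{k+1}(c)}\right)^2, & \text{if } r=k,\\[6pt] 0, & \text{otherwise}. \end{cases} \] In addition, the $r=k$ case also holds when $k=0$; namely, for all integers $n\ge 0$, \[ \det_{0\leq i,j \leq n-1}\big(\mathrm{Cat}_{i+j+2,0}^{(0,c)}\big) = \sum_{j=1}^{n+1} \big(F_{j}(c)\big)^2. \]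
   Context: For a sequence $(s_k)_{k\ge 0}$, let $\mathrm{Cat}_{n,k}^{(s)}$ be the array defined for $n\ge 1$, $k\ge 0$ by $\mathrm{Cat}_{n,k}^{(s)}=\mathrm{Cat}_{n-1,k-1}^{(s)}+s_k \mathrm{Cat}_{n-1,k}^{(s)}+\mathrm{Cat}_{n-1,k+1}^{(s)}$, with boundary values $\mathrm{Cat}_{0,0}^{(s)}=1$, $\mathrm{Cat}_{0,k}^{(s)}=0$ for $k\ge 1$, and $\mathrm{Cat}_{n,k}^{(s)}=0$ for $k<0$. For $b\in\{0,1\}$ write $\mathrm{Cat}_{n,k}^{(b,c)}$ for $\mathrm{Cat}_{n,k}^{(s)}$ with $s=(b+c,c,c,c,\ldots)$, i.e. $s_0=b+c$ and $s_k=c$ for $k\ge 1$. The polynomials $F_n(x)$ are defined by $F_0(x)=0$, $F_1(x)=1$, $F_n(x)=xF_{n-1}(x)-F_{n-2}(x)$ for $n\ge 2$. The notation $\det_{0\le i,j\le N-1}(a_{i,j})$ is the determinant of the $N\times N$ matrix $(a_{i,j})$; the empty determinant ($N=0$) is $1$. *)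

theory Defs
  imports "HOL-Computational_Algebra.Polynomial_Factorial" "Jordan_Normal_Form.Determinant"
begin

text \<open>The second index is a natural number; the convention that entries with a negative second
  index vanish accounts for the missing summand in the second equation.\<close>

fun Cat :: "(nat \<Rightarrow> 'a::comm_ring_1) \<Rightarrow> nat \<Rightarrow> nat \<Rightarrow> 'a" where
  "Cat s 0 k = (if k = 0 then 1 else 0)"
| "Cat s (Suc n) 0 = s 0 * Cat s n 0 + Cat s n 1"
| "Cat s (Suc n) (Suc k) = Cat s n k + s (Suc k) * Cat s n (Suc k) + Cat s n (Suc (Suc k))"

definition Cat2 :: "'a::comm_ring_1 \<Rightarrow> 'a \<Rightarrow> nat \<Rightarrow> nat \<Rightarrow> 'a" where
  "Cat2 b c = Cat (\<lambda>k. if k = 0 then b + c else c)"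

abbreviation indet :: "int poly" where
  "indet \<equiv> [:0, 1:]"

text \<open>Polynomials in \<open>indet\<close>, so \<open>F n\<close> is itself the value of the $n$-th polynomial at the
  indeterminate.\<close>

fun F :: "nat \<Rightarrow> int poly" where
  "F 0 = 0"
| "F (Suc 0) = 1"
| "F (Suc (Suc n)) = indet * F (Suc n) - F n"

definition hankel_det :: "nat \<Rightarrow> nat \<Rightarrow> int poly" where
  "hankel_det k N = det (mat N N (\<lambda>(i, j). Cat2 0 indet (i + j + 2) k))"

text \<open>Quotients are taken in the field of fractions: polynomial \<open>div\<close> would only give the
  true quotient once exact divisibility is known.\<close>

definition F_quot :: "nat \<Rightarrow> nat \<Rightarrow> int poly fract" where
  "F_quot m l = to_fract (F m) / to_fract (F l)"

end

theory Submission
  imports Defs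
begin

text \<open>Write $S_n(t)$ (\<open>chebS\<close>) for the polynomials with $S_0 = 0$, $S_1 = 1$, $S_{n+1} = t
S_n - S_{n-1}$, so that $F_n$ is $S_n$ at the indeterminate.  The sequence
$\mathrm{Cat}^{(0,c)}_{n,0}$ is the moment sequence of a linear functional $L$ on polynomials in
$x$, for which $U_{j+1} = S_{j+1}(x - c)$ is a monic orthonormal family, and
$\mathrm{Cat}^{(0,c)}_{n,k} = L(x^n U_{k+1})$.  So the determinant is the Hankel determinant of
$L$ multiplied by the weight $q = x^2 U_{k+1}$ of degree $k + 2$.

The argument is a division-free form of Christoffel's theorem
(\<open>hankel_eq_coeff_det\<close>): this Hankel determinant is the determinant of the
coefficient matrix of $$q, q x, \dots, q x^{N-1}, U_{N+1}, \dots, U_{N+k+2},$$ which depends on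
the last $k + 2$ polynomials only modulo $q$.  Modulo the factor $U_{k+1}$ the sequence $U_m$
reflects with a sign at every multiple of $k + 1$ (\<open>chebS_dvd_minus_residue\<close>), and
$U_{(k+1)j} = U_{k+1} G_j$ with $G_j = S_j(V)$ and $V = S_{k+2} - S_k$ taken at $x - c$.  With $N
= (k+1)n + r$ as in the theorem, put $M = (k+1)(n+1)$; this is the first multiple of $k + 1$ among
the window $N+1, \dots, N+k+2$ of indices.

For $r = 0$ and $r = k - 1$, the symmetric sum $U_{M+1} + U_{M-1} = (x - c) U_M$ trades one member
of the window for $x U_M$, which leaves $k$ consecutive polynomials between multiples of $k + 1$
and two multiples of $U_{k+1}$. Such a coefficient determinant factors
(\<open>coeff_det_factor\<close>): the $k$ residues modulo $U_{k+1}$ give a sign, and the pair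
$G_{n+1}, x G_{n+1}$ modulo $x^2$ gives $\pm G_{n+1}(0)^2$.  For $r = k$ the window starts and
ends with a multiple of $k + 1$, the pair is $G_{n+1}, G_{n+2}$, and its determinant modulo $x^2$
is the Wronskian at $0$, which telescopes to $V' \sum_j G_j^2$ with $V' = (k+1) U_{k+1}$; this
covers $k = 0$ too.  For the remaining $r$ the window contains $U_{M-2}, \dots, U_{M+2}$, whose
span contains $x^2 U_M = q G_{n+1}$, a combination of the $q x^j$; so the determinant vanishes.
Finally, values at $x = 0$ are values of $S$ and $V$ at $-c$, and parity turns them into values at
$c$.\<close>

section \<open>Rescaled Chebyshev polynomials\<close>

text \<open>$S_n(t) = U_{n-1}(t/2)$ for the Chebyshev polynomials $U$ of the second kind.  The argument ranges
over any commutative ring, so that the same recursion serves for numbers, polynomials and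
compositions.\<close>

fun chebS :: "'a::comm_ring_1 \<Rightarrow> nat \<Rightarrow> 'a" where
  "chebS t 0 = 0"
| "chebS t (Suc 0) = 1"
| "chebS t (Suc (Suc n)) = t * chebS t (Suc n) - chebS t n"

text \<open>$V_n(t) = 2 T_n(t/2)$ for the Chebyshev polynomials $T$ of the first kind.\<close>

fun chebV :: "'a::comm_ring_1 \<Rightarrow> nat \<Rightarrow> 'a" where
  "chebV t 0 = 2"
| "chebV t (Suc 0) = t"
| "chebV t (Suc (Suc n)) = t * chebV t (Suc n) - chebV t n"

lemma F_eq_chebS: "F n = chebS indet n"
  by (induction n rule: F.induct) auto

lemma chebS_uminus: "chebS (- t) (Suc n) = (- 1) ^ n * chebS t (Suc n)"
proof -
  have "chebS (- t) n = (- 1) ^ Suc n * chebS t n" for n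
    by (induction t n rule: chebS.induct) (auto simp: algebra_simps)
  from this[of "Suc n"] show ?thesis by simp
qed

lemma chebS_uminus_square: "(chebS (- t) n)\<^sup>2 = (chebS t n)\<^sup>2"
  by (cases n; cases "even (n - 1)") (auto simp: chebS_uminus)

lemma chebV_uminus: "chebV (- t) n = (- 1) ^ n * chebV t n"
  by (induction t n rule: chebV.induct) (auto simp: algebra_simps)

lemma chebS_chebV_uminus_square: "(chebS (chebV (- t) m) n)\<^sup>2 = (chebS (chebV t m) n)\<^sup>2"
  by (cases "even m") (auto simp: chebV_uminus chebS_uminus_square)

text \<open>With $t = 2 \cos \theta$ this is the identity $\sin (n + 2m)\theta + \sin n\theta = 2 \cos m\theta
\, \sin (n + m)\theta$.\<close>

lemma chebS_add_add: "chebS t (n + 2 * m) + chebS t n = chebV t m * chebS t (n + m)"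
proof (induction t m arbitrary: n rule: chebV.induct)
  case (3 t m)
  have "chebV t (Suc (Suc m)) * chebS t (n + Suc (Suc m))
      = t * (chebV t (Suc m) * chebS t (Suc n + Suc m)) - chebV t m * chebS t (Suc (Suc n) + m)"
    by (simp add: algebra_simps)
  also have "\<dots> = t * (chebS t (Suc n + 2 * Suc m) + chebS t (Suc n))
      - (chebS t (Suc (Suc n) + 2 * m) + chebS t (Suc (Suc n)))"
    unfolding "3.IH"(1)[symmetric] "3.IH"(2)[symmetric] ..
  also have "\<dots> = chebS t (n + 2 * Suc (Suc m)) + chebS t n"
    by (simp add: algebra_simps)
  finally show ?case ..
qed auto

text \<open>For fixed $m$ the values $S_{mn}$ satisfy the recursion of $S$ with $t$ replaced by $V_m$, which
is the identity \<open>chebS_add_add\<close> with step $m$.  So the quotients of the theorem are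
polynomials.\<close>

lemma chebS_mult: "chebS t (m * n) = chebS t m * chebS (chebV t m) n"
proof (induction "chebV t m" n rule: chebS.induct)
  case (3 n)
  have "chebS t (m * n + 2 * m) = chebV t m * chebS t (m * n + m) - chebS t (m * n)"
    using chebS_add_add[of t "m * n" m] by (simp add: algebra_simps)
  moreover have "m * n + 2 * m = m * Suc (Suc n)" "m * n + m = m * Suc n" by simp_all
  ultimately have "chebS t (m * Suc (Suc n)) = chebV t m * chebS t (m * Suc n) - chebS t (m * n)" by metis
  also have "\<dots> = chebS t m * chebS (chebV t m) (Suc (Suc n))"
    unfolding 3 by (simp add: algebra_simps)
  finally show ?case .
qed auto

text \<open>The reflected index: on an odd block, the residue of $S_{mn+s}$ modulo $S_m$ runs backwards and
with a minus sign.\<close>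

definition chebS_residue :: "'a::comm_ring_1 \<Rightarrow> nat \<Rightarrow> nat \<Rightarrow> nat \<Rightarrow> 'a" where
  "chebS_residue t m n s = (if even n then chebS t s else - chebS t (m - s))"

text \<open>The sum $S_{m(n+1)+s} + S_{m(n+1)-s}$ is $V_s S_{m(n+1)}$, a multiple of $S_m$.  So passing a
multiple of $m$ reflects the index and changes the sign, and two reflections cancel.\<close>

lemma chebS_dvd_minus_residue:
  assumes "s \<le> m"
  shows "chebS t m dvd chebS t (m * n + s) - chebS_residue t m n s"
  using assms
proof (induction n arbitrary: s)
  case (Suc n)
  have "chebS t (m * n + (m - s) + 2 * s) + chebS t (m * n + (m - s)) = chebV t s * chebS t (m * n + (m - s) + s)"
    by (rule chebS_add_add)
  also have "m * n + (m - s) + 2 * s = m * Suc n + s" using Suc.prems by simp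
  also have "m * n + (m - s) + s = m * Suc n" using Suc.prems by simp
  finally have "chebS t (m * Suc n + s) + chebS t (m * n + (m - s)) = chebS t m * (chebV t s * chebS (chebV t m) (Suc n))"
    by (simp only: chebS_mult mult_ac)
  hence "chebS t m dvd chebS t (m * Suc n + s) + chebS t (m * n + (m - s))" by simp
  moreover have "chebS t m dvd chebS t (m * n + (m - s)) - chebS_residue t m n (m - s)"
    by (rule Suc.IH) simp
  ultimately have "chebS t m dvd (chebS t (m * Suc n + s) + chebS t (m * n + (m - s)))
      - (chebS t (m * n + (m - s)) - chebS_residue t m n (m - s))" by (rule dvd_diff)
  moreover have "chebS_residue t m (Suc n) s = - chebS_residue t m n (m - s)"
    using Suc.prems by (auto simp: chebS_residue_def)
  ultimately show ?case by simp
qed (auto simp: chebS_residue_def)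

lemma chebV_Suc: "chebV t (Suc n) = chebS t (Suc (Suc n)) - chebS t n"
proof (induction t n rule: chebS.induct)
  case (3 t n)
  have "chebV t (Suc (Suc (Suc n))) = t * chebV t (Suc (Suc n)) - chebV t (Suc n)" by (rule chebV.simps)
  also have "\<dots> = chebS t (Suc (Suc (Suc (Suc n)))) - chebS t (Suc (Suc n))"
    unfolding 3 by (simp add: algebra_simps)
  finally show ?case .
qed auto

lemma pderiv_chebV:
  fixes t :: "'a::idom poly"
  shows "pderiv (chebV t n) = of_nat n * chebS t n * pderiv t"
proof (induction t n rule: chebV.induct)
  case (3 t n)
  have "pderiv (chebV t (Suc (Suc n))) = t * pderiv (chebV t (Suc n)) + pderiv t * chebV t (Suc n) - pderiv (chebV t n)"
    by (simp add: pderiv_diff pderiv_mult)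
  also have "\<dots> = of_nat (Suc (Suc n)) * chebS t (Suc (Suc n)) * pderiv t"
    unfolding 3 by (simp add: chebV_Suc algebra_simps)
  finally show ?case .
qed (auto simp: pderiv_numeral)

text \<open>By the recursion, the Wronskian of $S_{n+1}, S_{n+2}$ exceeds that of $S_n, S_{n+1}$ by $t'
S_{n+1}^2$, the term that comes from differentiating the factor $t$; so it telescopes.\<close>

lemma chebS_wronskian:
  fixes t :: "'a::idom poly"
  shows "chebS t n * pderiv (chebS t (Suc n)) - pderiv (chebS t n) * chebS t (Suc n)
    = pderiv t * (\<Sum>j = 1..n. (chebS t j)\<^sup>2)"
  by (induction n) (auto simp: pderiv_diff pderiv_mult algebra_simps power2_eq_square)

lemma poly_chebS: "poly (chebS t n) a = chebS (poly t a) n"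
  by (induction t n rule: chebS.induct) auto

lemma poly_chebV: "poly (chebV t n) a = chebV (poly t a) n"
  by (induction t n rule: chebV.induct) auto

lemma chebS_linear:
  fixes a :: "'a::idom"
  shows "degree (chebS [:a, 1:] (Suc n)) = n \<and> lead_coeff (chebS [:a, 1:] (Suc n)) = 1"
proof (induction n rule: less_induct)
  case (less n)
  consider "n = 0" | "n = 1" | m where "n = Suc (Suc m)"
    by (metis One_nat_def not0_implies_Suc)
  thus ?case
  proof cases
    case (3 m)
    let ?s = "chebS [:a, 1:]"
    have IH: "degree (?s (Suc m)) = m" "degree (?s (Suc (Suc m))) = Suc m"
        "lead_coeff (?s (Suc (Suc m))) = 1"
      using less[of m] less[of "Suc m"] 3 by (auto simp del: chebS.simps)
    have eq: "?s (Suc n) = [:a, 1:] * ?s (Suc (Suc m)) + - ?s (Suc m)" using 3 by simp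
    have "?s (Suc (Suc m)) \<noteq> 0" using IH(2) by (auto simp del: chebS.simps)
    hence d: "degree ([:a, 1:] * ?s (Suc (Suc m))) = n"
      using IH(2) 3 by (subst degree_mult_eq) (auto simp del: chebS.simps)
    have l: "lead_coeff ([:a, 1:] * ?s (Suc (Suc m))) = 1"
      using IH(3) lead_coeff_mult[of "[:a, 1:]" "?s (Suc (Suc m))"] by (simp del: chebS.simps mult_pCons_left)
    have "degree (- ?s (Suc m)) < degree ([:a, 1:] * ?s (Suc (Suc m)))"
      unfolding d using IH(1) 3 by (simp del: chebS.simps)
    hence "degree (?s (Suc n)) = n" unfolding eq using d by (subst degree_add_eq_left)
    moreover have "coeff (?s (Suc n)) n = 1"
      using l IH(1) 3 unfolding eq d by (simp add: coeff_eq_0 del: chebS.simps mult_pCons_left)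
    ultimately show ?thesis by (simp del: chebS.simps)
  qed auto
qed

lemma degree_chebS_linear: "degree (chebS [:a::'a::idom, 1:] n) = n - 1"
  using chebS_linear[of a "n - 1"] by (cases n) auto

lemma monic_chebS_linear: "n > 0 \<Longrightarrow> lead_coeff (chebS [:a::'a::idom, 1:] n) = 1"
  using chebS_linear[of a "n - 1"] by (cases n) auto

lemma coeff_chebS_linear: "coeff (chebS [:a::'a::idom, 1:] (Suc n)) n = 1"
  using chebS_linear[of a n] by (metis (no_types))

lemma degree_chebS_chebV:
  fixes a :: "'a::idom"
  assumes "m > 0"
  shows "degree (chebS (chebV [:a, 1:] m) (Suc n)) = m * n"
proof -
  let ?t = "[:a, 1:]"
  have "m * Suc n > 0" using assms by simp
  hence nz: "chebS ?t (m * Suc n) \<noteq> 0" using monic_chebS_linear[of "m * Suc n" a] by auto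
  have "degree (chebS ?t (m * Suc n)) = degree (chebS ?t m) + degree (chebS (chebV ?t m) (Suc n))"
    using nz unfolding chebS_mult by (subst degree_mult_eq) auto
  thus ?thesis using assms by (simp add: degree_chebS_linear)
qed

section \<open>Determinants of coefficient lists\<close>

text \<open>The rows are the polynomials, and column $j$ holds the coefficients of $x^j$.  Coefficients from
the length of the list on are cut off, so the value is meaningful for polynomials of degree below
that length.\<close>

definition coeff_det :: "'a::idom poly list \<Rightarrow> 'a" where
  "coeff_det fs = det (mat (length fs) (length fs) (\<lambda>(i, j). coeff (fs ! i) j))"

lemma coeff_det_change_basis:
  assumes len: "length es = length fs" and C: "C \<in> carrier_mat (length fs) (length fs)"
    and exp: "\<And>i. i < length fs \<Longrightarrow> fs ! i = (\<Sum>l<length fs. smult (C $$ (i, l)) (es ! l))"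
  shows "coeff_det fs = det C * coeff_det es"
proof -
  let ?n = "length fs"
  have "mat ?n ?n (\<lambda>(i, j). coeff (fs ! i) j) = C * mat ?n ?n (\<lambda>(i, j). coeff (es ! i) j)"
    using C by (intro eq_matI)
      (auto simp: exp scalar_prod_def coeff_sum atLeast0LessThan intro!: sum.cong)
  thus ?thesis unfolding coeff_det_def len by (simp add: det_mult[OF C])
qed

lemma coeff_det_monic:
  assumes "\<And>i. i < length fs \<Longrightarrow> degree (fs ! i) = i" "\<And>i. i < length fs \<Longrightarrow> lead_coeff (fs ! i) = 1"
  shows "coeff_det fs = 1"
proof -
  have "coeff_det fs = prod_list (diag_mat (mat (length fs) (length fs) (\<lambda>(i, j). coeff (fs ! i) j)))"
    unfolding coeff_det_def using assms(1)
    by (intro det_lower_triangular[of "length fs"]) (auto simp: coeff_eq_0)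
  also have "\<dots> = 1"
    unfolding prod_list_diag_prod
    by (rule prod.neutral) (use assms in fastforce)
  finally show ?thesis .
qed

lemma coeff_det_swap:
  "coeff_det (fs @ gs) = (- 1) ^ (length fs * length gs) * coeff_det (gs @ fs)"
proof -
  let ?k = "length fs" and ?n = "length gs"
  let ?M = "\<lambda>hs. mat (?k + ?n) (?k + ?n) (\<lambda>(i, j). coeff (hs ! i) j)"
  have "det (?M (fs @ gs)) = (- 1) ^ (?k * ?n) *
      det (mat (?k + ?n) (?k + ?n) (\<lambda>(i, j). ?M (fs @ gs) $$
        (if i < ?n then i + ?k else if i < ?k + ?n then i - ?n else i, j)))"
    by (rule det_swap_initial_rows) auto
  also have "mat (?k + ?n) (?k + ?n) (\<lambda>(i, j). ?M (fs @ gs) $$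
        (if i < ?n then i + ?k else if i < ?k + ?n then i - ?n else i, j)) = ?M (gs @ fs)"
    by (rule eq_matI) (auto simp: nth_append)
  finally show ?thesis by (simp add: coeff_det_def add.commute)
qed

lemma coeff_det_smult:
  "coeff_det (map (smult a) fs) = a ^ length fs * coeff_det fs"
proof -
  have "mat (length fs) (length fs) (\<lambda>(i, j). coeff (map (smult a) fs ! i) j)
      = a \<cdot>\<^sub>m mat (length fs) (length fs) (\<lambda>(i, j). coeff (fs ! i) j)"
    by (rule eq_matI) auto
  thus ?thesis by (simp add: coeff_det_def)
qed

interpretation poly_module: Modules.module "smult :: 'a::comm_ring_1 \<Rightarrow> 'a poly \<Rightarrow> 'a poly"
  by unfold_locales (auto simp: smult_add_left smult_add_right)

lemma coeff_det_add_smult: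
  assumes "g \<in> set (as @ bs)"
  shows "coeff_det (as @ (f + smult c g) # bs) = coeff_det (as @ f # bs)"
proof -
  let ?n = "length (as @ f # bs)" and ?k = "length as"
  \<comment> \<open>The position of \<open>g\<close> in the list that contains \<open>f\<close>.\<close>
  obtain l where l: "l < ?n" "l \<noteq> ?k" "(as @ f # bs) ! l = g"
  proof -
    from assms consider i where "i < length as" "as ! i = g" | i where "i < length bs" "bs ! i = g"
      by (auto simp: in_set_conv_nth)
    thus thesis
    proof cases
      case 1 thus thesis by (intro that[of i]) (auto simp: nth_append)
    next
      case 2 thus thesis by (intro that[of "?k + Suc i"]) (auto simp: nth_append)
    qed
  qed
  let ?A = "mat ?n ?n (\<lambda>(i, j). coeff ((as @ f # bs) ! i) j)"
  have "mat ?n ?n (\<lambda>(i, j). coeff ((as @ (f + smult c g) # bs) ! i) j) = addrow c ?k l ?A"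
    using l by (intro eq_matI) (auto simp: nth_append nth_Cons')
  moreover have "det (addrow c ?k l ?A) = det ?A"
    using l by (intro det_addrow) auto
  ultimately show ?thesis by (simp add: coeff_det_def)
qed

text \<open>Iterated elementary row operations.  All replacements of members of the window below are of this
kind.\<close>

lemma coeff_det_add_span:
  assumes "h \<in> poly_module.span (set (as @ bs))"
  shows "coeff_det (as @ (f + h) # bs) = coeff_det (as @ f # bs)"
  using assms
proof (induction h rule: poly_module.span_induct_alt)
  case (step c g h)
  have "coeff_det (as @ ((f + h) + smult c g) # bs) = coeff_det (as @ (f + h) # bs)"
    by (rule coeff_det_add_smult) (rule step)
  with step show ?case by (simp add: add_ac)
qed auto

lemma coeff_det_span_eq_0:
  assumes "h \<in> poly_module.span (set (as @ bs))"
  shows "coeff_det (as @ h # bs) = 0"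
proof -
  have "coeff_det (as @ h # bs) = coeff_det (as @ smult 0 0 # bs)"
    using coeff_det_add_span[OF assms, of 0] by simp
  also have "\<dots> = 0"
  proof -
    let ?n = "length (as @ 0 # bs)"
    let ?A = "mat ?n ?n (\<lambda>(i, j). coeff ((as @ 0 # bs) ! i) j)"
    have "multrow (length as) 0 ?A = ?A"
      by (rule eq_matI) (auto simp: nth_append)
    hence "det ?A = 0" using det_multrow[of "length as" ?n ?A 0] by simp
    thus ?thesis by (simp add: coeff_det_def)
  qed
  finally show ?thesis .
qed

lemma poly_eq_sum_monom_lessThan:
  fixes p :: "'a::comm_ring_1 poly"
  assumes "degree p < n"
  shows "p = (\<Sum>l<n. smult (coeff p l) (monom 1 l))"
proof (rule poly_eqI)
  fix i
  have "(\<Sum>l<n. coeff p l * (if l = i then 1 else 0)) = coeff p i"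
    using assms by (auto simp: coeff_eq_0 if_distrib cong: if_cong)
  thus "coeff p i = coeff (\<Sum>l<n. smult (coeff p l) (monom 1 l)) i"
    by (simp add: coeff_sum)
qed

lemma poly_eq_sum_monom_zero:
  fixes p :: "'a::comm_ring_1 poly"
  assumes "p = 0 \<or> degree p < n"
  shows "p = (\<Sum>l<n. smult (coeff p l) (monom 1 l))"
  using assms poly_eq_sum_monom_lessThan by auto

lemma mult_in_span:
  assumes "degree g < n"
  shows "q * g \<in> poly_module.span ((\<lambda>j. q * monom 1 j) ` {..<n})"
proof -
  have "q * g = (\<Sum>l<n. smult (coeff g l) (q * monom 1 l))"
    by (subst poly_eq_sum_monom_lessThan[OF assms]) (simp add: sum_distrib_left)
  also have "\<dots> \<in> poly_module.span ((\<lambda>j. q * monom 1 j) ` {..<n})"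
    by (intro poly_module.span_sum poly_module.span_scale poly_module.span_base) auto
  finally show ?thesis .
qed

text \<open>In the basis $1, x, \dots, x^{k-1}, q, q x, \dots, q x^{n-1}$ with $k$ the degree of $q$, which is
unitriangular over the monomials, the coefficient matrix is block upper triangular: the blocks on
the diagonal are the residues modulo $q$ of the first $k$ polynomials and the cofactors of $q$ in
the others.\<close>

lemma coeff_det_factor:
  fixes q :: "'a::idom poly"
  assumes q: "lead_coeff q = 1" and rs: "length rs = degree q" and gs: "length gs = degree q"
    and r_deg: "\<And>r. r \<in> set rs \<Longrightarrow> degree r < degree q"
    and h_deg: "\<And>h. h \<in> set hs \<Longrightarrow> degree h < length hs"
    and g_deg: "\<And>g. g \<in> set gs \<Longrightarrow> degree g < degree q + length hs"
    and cong: "\<And>i. i < degree q \<Longrightarrow> q dvd gs ! i - rs ! i"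
  shows "coeff_det (gs @ map ((*) q) hs) = coeff_det rs * coeff_det hs"
proof -
  let ?k = "degree q" and ?n = "length hs"
  from cong obtain b where b: "\<And>i. i < ?k \<Longrightarrow> gs ! i - rs ! i = q * b i"
    unfolding dvd_def by metis
  have qnz: "q \<noteq> 0" using q by auto
  have g_eq: "gs ! i = rs ! i + q * b i" if "i < ?k" for i
    using b[OF that] by (simp add: algebra_simps)
  \<comment> \<open>Since \<open>q\<close> is monic, division by it lowers the degree by exactly its own degree.\<close>
  have b_small: "b i = 0 \<or> degree (b i) < ?n" if i: "i < ?k" for i
  proof (rule disjCI)
    assume "\<not> degree (b i) < ?n"
    show "b i = 0"
    proof (rule ccontr)
      assume "b i \<noteq> 0"
      hence "degree (q * b i) = ?k + degree (b i)" using qnz by (simp add: degree_mult_eq)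
      moreover have "degree (gs ! i - rs ! i) < ?k + ?n"
        using i rs gs r_deg[of "rs ! i"] g_deg[of "gs ! i"] by (intro degree_diff_less) auto
      ultimately show False using b[OF i] \<open>\<not> degree (b i) < ?n\<close> by simp
    qed
  qed
  define es where "es = map (monom 1) [0..<?k] @ map (\<lambda>j. q * monom 1 j) [0..<?n]"
  let ?R = "mat ?k ?k (\<lambda>(i, j). coeff (rs ! i) j)"
  let ?B = "mat ?k ?n (\<lambda>(i, j). coeff (b i) j)"
  let ?H = "mat ?n ?n (\<lambda>(i, j). coeff (hs ! i) j)"
  let ?C = "four_block_mat ?R ?B (0\<^sub>m ?n ?k) ?H"
  have split: "(\<Sum>l<m + n. f l) = (\<Sum>l<m. f l) + (\<Sum>l<n. f (m + l))"
    for f :: "nat \<Rightarrow> 'a poly" and m n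
    by (induction n) (auto simp: add_ac)
  have "coeff_det (gs @ map ((*) q) hs) = det ?C * coeff_det es"
  proof (rule coeff_det_change_basis)
    fix i assume "i < length (gs @ map ((*) q) hs)"
    hence i: "i < ?k + ?n" using gs by simp
    show "(gs @ map ((*) q) hs) ! i
        = (\<Sum>l<length (gs @ map ((*) q) hs). smult (?C $$ (i, l)) (es ! l))"
    proof (cases "i < ?k")
      case True
      have "rs ! i = (\<Sum>l<?k. smult (coeff (rs ! i) l) (monom 1 l))"
        using True rs by (intro poly_eq_sum_monom_lessThan r_deg) auto
      moreover have "q * b i = (\<Sum>l<?n. smult (coeff (b i) l) (q * monom 1 l))"
        by (subst poly_eq_sum_monom_zero[OF b_small[OF True]]) (simp add: sum_distrib_left)
      ultimately show ?thesis
        using True gs by (simp add: g_eq split es_def nth_append)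
    next
      case False
      have "q * hs ! (i - ?k) = (\<Sum>l<?n. smult (coeff (hs ! (i - ?k)) l) (q * monom 1 l))"
        using False i by (subst poly_eq_sum_monom_lessThan[OF h_deg[of "hs ! (i - ?k)"]])
          (auto simp: sum_distrib_left)
      thus ?thesis using False i gs by (simp add: split es_def nth_append)
    qed
  qed (use gs in \<open>auto simp: es_def\<close>)
  moreover have "coeff (q * monom 1 (i - ?k)) i = 1" if "\<not> i < ?k" for i
    using coeff_mult_degree_sum[of q "monom 1 (i - ?k)"] q that by (simp add: degree_monom_eq)
  hence "coeff_det es = 1"
    using qnz q by (intro coeff_det_monic)
      (auto simp: es_def nth_append degree_mult_eq degree_monom_eq monom_eq_0_iff lead_coeff_mult)
  moreover have "det ?C = coeff_det rs * coeff_det hs"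
    by (subst det_four_block_mat_lower_left_zero[of _ ?k _ ?n]) (auto simp: coeff_det_def rs)
  ultimately show ?thesis by simp
qed

section \<open>The moment functional and the Hankel determinant\<close>

lemma Cat_eq_0: "n < k \<Longrightarrow> Cat s n k = 0"
  by (induction s n k rule: Cat.induct) auto

lemma Cat_diag: "Cat s n n = 1"
  by (induction n) (auto simp: Cat_eq_0)

lemma Cat2_0: "Cat2 0 c = Cat (\<lambda>_. c)"
  by (auto simp: Cat2_def cong: if_cong)

text \<open>The linear functional with moments $\mathrm{Cat}^{(0,c)}_{l,0}$.\<close>

definition moment :: "'a::idom \<Rightarrow> 'a poly \<Rightarrow> 'a" where
  "moment c f = (\<Sum>l\<le>degree f. coeff f l * Cat2 0 c l 0)"

lemma moment_eq_sum:
  assumes "degree f < n"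
  shows "moment c f = (\<Sum>l<n. coeff f l * Cat2 0 c l 0)"
  unfolding moment_def using assms
  by (intro sum.mono_neutral_left) (auto simp: coeff_eq_0)

lemma moment_0 [simp]: "moment c 0 = 0"
  by (simp add: moment_def)

lemma moment_add: "moment c (f + g) = moment c f + moment c g"
proof -
  let ?n = "Suc (max (degree f) (degree g))"
  have "degree (f + g) < ?n" using degree_add_le_max[of f g] by simp
  thus ?thesis
    by (subst (1 2 3) moment_eq_sum[where n = ?n]) (auto simp: sum.distrib algebra_simps)
qed

lemma moment_smult: "moment c (smult a f) = a * moment c f"
  by (subst (1 2) moment_eq_sum[where n = "Suc (degree f)"])
    (auto simp: sum_distrib_left mult_ac intro: le_less_trans[OF degree_smult_le] simp del: sum.lessThan_Suc)

lemma moment_diff: "moment c (f - g) = moment c f - moment c g"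
  using moment_add[of c f "smult (- 1) g"] moment_smult[of c "- 1" g] by simp

lemma moment_sum: "moment c (\<Sum>i\<in>I. f i) = (\<Sum>i\<in>I. moment c (f i))"
  by (induction I rule: infinite_finite_induct) (auto simp: moment_add)

lemma moment_mult_expand:
  assumes "degree g < n"
  shows "moment c (f * g) = (\<Sum>l<n. coeff g l * moment c (f * monom 1 l))"
proof -
  have "f * g = (\<Sum>l<n. smult (coeff g l) (f * monom 1 l))"
    by (subst poly_eq_sum_monom_lessThan[OF assms]) (simp add: sum_distrib_left)
  thus ?thesis by (simp add: moment_sum moment_smult)
qed

text \<open>Both sides obey the recursion that defines the array, read as a formula for column $k + 1$ in
terms of columns $k$ and $k - 1$.  So it is enough that they agree in column $0$, where they agree
by definition.  Orthonormality of the $U_{k+1}$ is then a consequence of the unitriangular shape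
of the array.\<close>

lemma moment_monom_mult_chebS:
  "moment c (monom 1 n * chebS [:- c, 1:] (Suc k)) = Cat2 0 c n k"
proof (induction k arbitrary: n rule: less_induct)
  case (less k)
  let ?s = "chebS [:- c, 1:]"
  have step: "monom 1 n * ([:- c, 1:] * g) = monom 1 (Suc n) * g - smult c (monom 1 n * g)" for g
  proof -
    have "[:- c, 1:] * g = monom 1 1 * g - smult c g" by (simp add: monom_altdef)
    moreover have "monom 1 (Suc n) = monom (1 :: 'a) n * monom 1 1" by (simp add: mult_monom)
    ultimately show ?thesis by (simp only: right_diff_distrib mult_smult_right mult.assoc)
  qed
  have zero: "moment c (monom 1 i) = Cat2 0 c i 0" for i
    by (subst moment_eq_sum[of _ "Suc i"])
      (auto simp: degree_monom_eq if_distrib if_distribR cong: if_cong)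
  consider "k = 0" | "k = 1" | j where "k = Suc (Suc j)"
    by (metis One_nat_def not0_implies_Suc)
  thus ?case
  proof cases
    case 1
    thus ?thesis by (simp add: zero)
  next
    case 2
    have "monom 1 n * ?s (Suc k) = monom 1 (Suc n) - smult c (monom 1 n)"
      using step[of 1] 2 by simp
    thus ?thesis using 2 by (simp add: moment_diff moment_smult zero Cat2_0)
  next
    case (3 j)
    have "monom 1 n * ?s (Suc k) = monom 1 n * ([:- c, 1:] * ?s (Suc (Suc j))) - monom 1 n * ?s (Suc j)"
      using 3 by (simp only: chebS.simps(3) right_diff_distrib)
    also have "\<dots> = monom 1 (Suc n) * ?s (Suc (Suc j)) - smult c (monom 1 n * ?s (Suc (Suc j)))
        - monom 1 n * ?s (Suc j)"
      unfolding step ..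
    finally have "moment c (monom 1 n * ?s (Suc k))
        = Cat2 0 c (Suc n) (Suc j) - c * Cat2 0 c n (Suc j) - Cat2 0 c n j"
      using 3 by (simp add: moment_diff moment_smult less del: chebS.simps)
    thus ?thesis using 3 by (simp add: Cat2_0)
  qed
qed

lemma moment_mult_chebS:
  assumes "degree f < n"
  shows "moment c (f * chebS [:- c, 1:] (Suc k)) = (\<Sum>l<n. coeff f l * Cat2 0 c l k)"
proof -
  have "moment c (f * chebS [:- c, 1:] (Suc k)) = moment c (chebS [:- c, 1:] (Suc k) * f)"
    by (simp add: mult.commute)
  also have "\<dots> = (\<Sum>l<n. coeff f l * moment c (chebS [:- c, 1:] (Suc k) * monom 1 l))"
    by (rule moment_mult_expand[OF assms])
  also have "\<dots> = (\<Sum>l<n. coeff f l * Cat2 0 c l k)"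
    by (simp add: mult.commute[of _ "monom 1 _"] moment_monom_mult_chebS del: chebS.simps)
  finally show ?thesis .
qed

lemma moment_chebS_mult_chebS:
  "moment c (chebS [:- c, 1:] (Suc i) * chebS [:- c, 1:] (Suc k)) = (if i = k then 1 else 0)"
proof -
  have less: "moment c (chebS [:- c, 1:] (Suc i) * chebS [:- c, 1:] (Suc k)) = 0" if "i < k" for i k
    using that by (subst moment_mult_chebS[where n = "Suc i"])
      (auto simp: degree_chebS_linear Cat2_0 Cat_eq_0 simp del: chebS.simps)
  have eq: "moment c (chebS [:- c, 1:] (Suc k) * chebS [:- c, 1:] (Suc k)) = 1"
    using chebS_linear[of "- c" k] by (subst moment_mult_chebS[where n = "Suc k"])
      (auto simp: Cat2_0 Cat_eq_0 Cat_diag lessThan_Suc simp del: chebS.simps)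
  show ?thesis using less[of i k] less[of k i] eq
    by (cases i k rule: linorder_cases) (auto simp: mult.commute simp del: chebS.simps)
qed

text \<open>Multiplying the coefficient matrix on the right by the unitriangular matrix of the array turns the
row of $f$ into the values $L(f U_{j+1})$.  By orthonormality the rows of $U_{N+1}, U_{N+2},
\dots$ become unit vectors, so that only the block $L(q x^i U_{j+1})$ with $i, j < N$ remains,
which differs from the Hankel matrix by the unitriangular change of basis from $U_{j+1}$ to the
monomials.\<close>

lemma hankel_eq_coeff_det:
  "det (mat N N (\<lambda>(i, j). moment c (q * monom 1 (i + j))))
    = coeff_det (map (\<lambda>j. q * monom 1 j) [0..<N] @ map (chebS [:- c, 1:]) [Suc N..<Suc N + degree q])"
proof -
  let ?s = "chebS [:- c, 1:]" and ?m = "degree q"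
  let ?n = "N + ?m"
  let ?fs = "map (\<lambda>j. q * monom 1 j) [0..<N] @ map ?s [Suc N..<Suc N + ?m]"
  let ?A = "mat ?n ?n (\<lambda>(i, j). coeff (?fs ! i) j)"
  let ?W = "mat ?n ?n (\<lambda>(l, i). Cat2 0 c l i)"
  let ?D = "mat N N (\<lambda>(i, j). moment c (q * monom 1 i * ?s (Suc j)))"
  let ?E = "mat N ?m (\<lambda>(i, j). moment c (q * monom 1 i * ?s (Suc (N + j))))"
  let ?H = "mat N N (\<lambda>(i, j). moment c (q * monom 1 (i + j)))"
  let ?P = "mat N N (\<lambda>(l, j). coeff (?s (Suc j)) l)"
  have deg: "degree (?fs ! i) < ?n" if "i < ?n" for i
  proof (cases "i < N")
    case True
    have "degree (q * monom 1 i) \<le> ?m + i"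
      using degree_mult_le[of q "monom 1 i"] by (simp add: degree_monom_eq)
    thus ?thesis using True by (simp add: nth_append)
  next
    case False
    thus ?thesis using that by (simp add: nth_append degree_chebS_linear del: upt_Suc)
  qed
  have "?A * ?W = four_block_mat ?D ?E (0\<^sub>m ?m N) (1\<^sub>m ?m)"
  proof (rule eq_matI)
    fix i j assume "i < dim_row (four_block_mat ?D ?E (0\<^sub>m ?m N) (1\<^sub>m ?m))"
      "j < dim_col (four_block_mat ?D ?E (0\<^sub>m ?m N) (1\<^sub>m ?m))"
    hence ij: "i < ?n" "j < ?n" by auto
    have "(?A * ?W) $$ (i, j) = (\<Sum>l<?n. coeff (?fs ! i) l * Cat2 0 c l j)"
      using ij by (simp add: scalar_prod_def atLeast0LessThan del: upt_Suc)
    also have "\<dots> = moment c (?fs ! i * ?s (Suc j))"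
      using moment_mult_chebS[OF deg[OF ij(1)]] by simp
    also have "\<dots> = four_block_mat ?D ?E (0\<^sub>m ?m N) (1\<^sub>m ?m) $$ (i, j)"
      using ij by (auto simp: nth_append moment_chebS_mult_chebS simp del: upt_Suc chebS.simps)
    finally show "(?A * ?W) $$ (i, j) = four_block_mat ?D ?E (0\<^sub>m ?m N) (1\<^sub>m ?m) $$ (i, j)" .
  qed auto
  hence "det ?A * det ?W = det (four_block_mat ?D ?E (0\<^sub>m ?m N) (1\<^sub>m ?m))"
    using det_mult[of ?A ?n ?W] by simp
  also have "\<dots> = det ?D"
    by (subst det_four_block_mat_lower_left_zero[of _ N _ ?m]) auto
  also have "det ?W = 1"
    by (subst det_lower_triangular[of ?n])
      (auto simp: Cat2_0 Cat_eq_0 Cat_diag prod_list_diag_prod)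
  also have "?D = ?H * ?P"
  proof (rule eq_matI)
    fix i j assume "i < dim_row (?H * ?P)" "j < dim_col (?H * ?P)"
    hence ij: "i < N" "j < N" by auto
    have "moment c (q * monom 1 i * ?s (Suc j))
        = (\<Sum>l<N. coeff (?s (Suc j)) l * moment c (q * monom 1 i * monom 1 l))"
      using ij by (intro moment_mult_expand) (simp add: degree_chebS_linear)
    also have "\<dots> = (\<Sum>l<N. moment c (q * monom 1 (i + l)) * coeff (?s (Suc j)) l)"
      by (simp add: mult.assoc mult_monom mult.commute[of "coeff _ _"] del: chebS.simps)
    finally show "?D $$ (i, j) = (?H * ?P) $$ (i, j)"
      using ij by (simp add: scalar_prod_def atLeast0LessThan del: chebS.simps)
  qed auto
  also have "det (?H * ?P) = det ?H * det ?P"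
    by (rule det_mult) auto
  also have "det ?P = 1"
  proof (subst det_upper_triangular[of _ N])
    show "prod_list (diag_mat ?P) = 1"
      by (auto simp: prod_list_diag_prod coeff_chebS_linear simp del: chebS.simps intro!: prod.neutral)
  qed (auto simp: upper_triangular_def degree_chebS_linear coeff_eq_0 simp del: chebS.simps)
  finally show ?thesis by (simp add: coeff_det_def del: upt_Suc)
qed

section \<open>Consecutive Chebyshev polynomials modulo a fixed one\<close>

lemma minus_one_power_choose_Suc:
  "(- 1 :: 'a::comm_ring_1) ^ (Suc k choose 2) = (- 1) ^ k * (- 1) ^ (k choose 2)"
  by (simp add: numeral_2_eq_2 power_add)

text \<open>Moving the first polynomial $S_{k+1}$ to the end costs the sign $(-1)^k$; there it splits off as a
factor, and the reversed list of the other $k$ polynomials is left.\<close>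

lemma coeff_det_rev_chebS:
  "coeff_det (map (chebS [:a, 1:]) (rev [1..<Suc k])) = (- 1) ^ (k choose 2)"
proof (induction k)
  case 0
  show ?case by (simp add: coeff_det_def numeral_2_eq_2)
next
  case (Suc k)
  let ?s = "chebS [:a, 1:]"
  let ?r = "map ?s (rev [1..<Suc k])"
  have "map ?s (rev [1..<Suc (Suc k)]) = [?s (Suc k)] @ ?r" by simp
  hence "coeff_det (map ?s (rev [1..<Suc (Suc k)])) = (- 1) ^ k * coeff_det (?r @ [?s (Suc k)])"
    using coeff_det_swap[of "[?s (Suc k)]" ?r] by (simp del: chebS.simps upt_Suc)
  also have "?r @ [?s (Suc k)] = ?r @ map ((*) (?s (Suc k))) [1]" by simp
  also have "coeff_det \<dots> = coeff_det ?r * coeff_det [1]"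
    by (rule coeff_det_factor)
      (auto simp: degree_chebS_linear coeff_chebS_linear simp del: chebS.simps)
  also have "coeff_det [1 :: 'a poly] = 1"
    by (rule coeff_det_monic) auto
  finally show ?case by (simp only: Suc.IH minus_one_power_choose_Suc mult_1_right)
qed

text \<open>On an even block the residues are monic of increasing degrees.  On an odd block they come in
reverse order and negated, which contributes the sign of the reversal and one sign for each row.\<close>

lemma coeff_det_residues:
  "coeff_det (map (chebS_residue [:a, 1:] (Suc k) n) [1..<Suc k]) = (- 1) ^ ((Suc k choose 2) * n)"
proof (cases "even n")
  case True
  have "coeff_det (map (chebS [:a, 1:]) [1..<Suc k]) = 1"
    by (rule coeff_det_monic)
      (auto simp: degree_chebS_linear coeff_chebS_linear simp del: chebS.simps upt_Suc)
  moreover have eq: "map (chebS_residue [:a, 1:] (Suc k) n) [1..<Suc k] = map (chebS [:a, 1:]) [1..<Suc k]"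
    using True by (simp add: chebS_residue_def del: upt_Suc)
  ultimately show ?thesis unfolding eq using True by simp
next
  case False
  have "map (chebS_residue [:a, 1:] (Suc k) n) [1..<Suc k]
      = map (smult (- 1)) (map (chebS [:a, 1:]) (rev [1..<Suc k]))"
    using False by (intro nth_equalityI) (auto simp: chebS_residue_def rev_nth Suc_diff_Suc simp del: upt_Suc chebS.simps)
  hence "coeff_det (map (chebS_residue [:a, 1:] (Suc k) n) [1..<Suc k]) = (- 1) ^ k * (- 1) ^ (k choose 2)"
    by (simp only: coeff_det_smult coeff_det_rev_chebS) (simp del: upt_Suc)
  also have "\<dots> = (- 1) ^ (Suc k choose 2)" by (simp only: minus_one_power_choose_Suc)
  also have "\<dots> = (- 1) ^ ((Suc k choose 2) * n)" using False by (simp add: minus_one_power_iff)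
  finally show ?thesis .
qed

text \<open>The common last step of all nonzero cases: a full block of $k$ consecutive polynomials between two
multiples of $k + 1$ contributes its sign, and the multiples of $U_{k+1}$ contribute the
determinant of their cofactors.\<close>

lemma coeff_det_chebS_window:
  fixes a :: "'a::idom"
  assumes "\<And>h. h \<in> set hs \<Longrightarrow> degree h < length hs" and "Suc k * n \<le> length hs"
  shows "coeff_det (map (chebS [:a, 1:]) [Suc k * n + 1..<Suc k * n + Suc k] @ map ((*) (chebS [:a, 1:] (Suc k))) hs)
    = (- 1) ^ ((Suc k choose 2) * n) * coeff_det hs"
proof -
  have "coeff_det (map (chebS [:a, 1:]) [Suc k * n + 1..<Suc k * n + Suc k] @ map ((*) (chebS [:a, 1:] (Suc k))) hs)
      = coeff_det (map (chebS_residue [:a, 1:] (Suc k) n) [1..<Suc k]) * coeff_det hs"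
  proof (rule coeff_det_factor)
    fix i assume "i < degree (chebS [:a, 1:] (Suc k))"
    hence "i < k" by (simp add: degree_chebS_linear)
    thus "chebS [:a, 1:] (Suc k) dvd map (chebS [:a, 1:]) [Suc k * n + 1..<Suc k * n + Suc k] ! i
        - map (chebS_residue [:a, 1:] (Suc k) n) [1..<Suc k] ! i"
      using chebS_dvd_minus_residue[of "Suc i" "Suc k" "[:a, 1:]" n]
      by (simp del: upt_Suc chebS.simps mult_Suc)
  next
    fix r assume "r \<in> set (map (chebS_residue [:a, 1:] (Suc k) n) [1..<Suc k])"
    thus "degree r < degree (chebS [:a, 1:] (Suc k))"
      by (auto simp: chebS_residue_def degree_chebS_linear simp del: chebS.simps upt_Suc)
  qed (use assms in \<open>auto simp: degree_chebS_linear coeff_chebS_linear simp del: chebS.simps upt_Suc\<close>)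
  thus ?thesis by (simp only: coeff_det_residues)
qed

lemma coeff_det_pair:
  "coeff_det [f, g] = coeff f 0 * coeff g 1 - coeff f 1 * coeff g 0"
  unfolding coeff_det_def
  by (subst laplace_expansion_row[of _ 2 0])
    (auto simp: numeral_2_eq_2 lessThan_Suc cofactor_def det_single mat_delete_def)

text \<open>The factorization with respect to $x^2$, whose cofactors $1, x, x^2, \dots$ have determinant $1$.\<close>

lemma coeff_det_mod_square:
  assumes "degree f < N + 2" "degree g < N + 2"
  shows "coeff_det ([f, g] @ map (\<lambda>j. monom 1 2 * monom 1 j) [0..<N])
    = coeff f 0 * coeff g 1 - coeff f 1 * coeff g 0"
proof -
  let ?x2 = "monom (1 :: 'a) 2"
  let ?r = "\<lambda>p. [:coeff p 0, coeff p 1 :: 'a:]"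
  have dvd: "?x2 dvd p - ?r p" for p
    by (auto simp: monom_1_dvd_iff' less_2_cases_iff)
  have deg: "degree (?r p) < degree ?x2" for p
    by (auto simp: degree_monom_eq)
  have "coeff_det ([f, g] @ map ((*) ?x2) (map (monom 1) [0..<N]))
      = coeff_det [?r f, ?r g] * coeff_det (map (monom 1) [0..<N])"
    by (rule coeff_det_factor)
      (use assms dvd deg in \<open>auto simp: degree_monom_eq nth_Cons' numeral_2_eq_2\<close>)
  also have "coeff_det (map (monom (1 :: 'a)) [0..<N]) = 1"
    by (rule coeff_det_monic) (auto simp: degree_monom_eq)
  finally show ?thesis by (simp add: coeff_det_pair comp_def)
qed

section \<open>The four residue classes of the size\<close>

lemma coeff_x_mult:
  "coeff (monom (1 :: 'a::comm_ring_1) (Suc 0) * p) 0 = 0"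
  "coeff (monom (1 :: 'a) (Suc 0) * p) (Suc n) = coeff p n"
  by (simp_all add: monom_altdef)

lemma degree_x_mult_le: "degree (monom (1::'a::comm_ring_1) 1 * p) \<le> Suc (degree p)"
  by (simp add: monom_altdef degree_pCons_le)

text \<open>The window is the list of indices $N + 1, \dots, N + k + 2$ of the orthogonal polynomials that
enter Christoffel's formula.\<close>

locale hankel_window =
  fixes c :: "'a::idom" and k n r N :: nat
  assumes N_eq: "N = (k + 1) * n + r" and r_le: "r \<le> k"
begin

abbreviation "U \<equiv> chebS [:- c, 1:]"
abbreviation "G \<equiv> chebS (chebV [:- c, 1:] (Suc k))"
abbreviation "x \<equiv> monom (1 :: 'a) 1"
abbreviation "x2 \<equiv> monom (1 :: 'a) 2"

definition M :: nat where "M = Suc k * Suc n"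

definition hankel :: 'a where
  "hankel = det (mat N N (\<lambda>(i, j). Cat2 0 c (i + j + 2) k))"

definition weight_multiples :: "'a poly list" where
  "weight_multiples = map (\<lambda>j. x2 * U (Suc k) * monom 1 j) [0..<N]"

text \<open>The cofactors of $U_{k+1}$ in the multiples of the weight.\<close>

definition square_multiples :: "'a poly list" where
  "square_multiples = map (\<lambda>j. x2 * monom 1 j) [0..<N]"

lemma length_weight_multiples [simp]: "length weight_multiples = N" "length square_multiples = N"
  by (simp_all add: weight_multiples_def square_multiples_def)

lemma weight_multiples_eq: "weight_multiples = map ((*) (U (Suc k))) square_multiples"
  by (simp add: weight_multiples_def square_multiples_def mult_ac)

lemma degree_square_multiples: "h \<in> set square_multiples \<Longrightarrow> degree h < N + 2"
  by (auto simp: square_multiples_def mult_monom degree_monom_eq)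

lemma M_eq: "M = N + Suc k - r"
  using r_le by (simp add: M_def N_eq)

text \<open>Christoffel's formula for the weight $q = x^2 U_{k+1}$ of degree $k + 2$.\<close>

lemma hankel_eq: "hankel = coeff_det (weight_multiples @ map U [Suc N..<N + k + 3])"
proof -
  have x2: "moment c (monom 1 (i + j + 2) * U (Suc k)) = moment c (x2 * U (Suc k) * monom 1 (i + j))" for i j
    by (simp add: mult_monom mult_ac add_ac flip: mult.assoc del: chebS.simps)
  have "degree (x2 * U (Suc k)) = k + 2"
    using coeff_chebS_linear[of "- c" k] by (subst degree_mult_eq)
      (auto simp: degree_monom_eq degree_chebS_linear monom_eq_0_iff simp del: chebS.simps)
  hence "Suc N + degree (x2 * U (Suc k)) = N + k + 3" by simp
  thus ?thesis
    unfolding hankel_def weight_multiples_def moment_monom_mult_chebS[symmetric] x2 hankel_eq_coeff_det by metis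
qed

lemma U_period: "U (Suc k * j) = U (Suc k) * G j"
  by (rule chebS_mult)

lemma degree_G: "degree (G (Suc j)) = Suc k * j"
  by (rule degree_chebS_chebV) simp

lemma U_neighbours: "U (Suc (Suc j)) = x * U (Suc j) + (smult (- 1) (U j) + smult (- c) (U (Suc j)))"
  by (simp add: monom_altdef)

lemma U_M: "U M = U (Suc k) * G (Suc n)" "U (M + Suc k) = U (Suc k) * G (Suc (Suc n))"
  using U_period[of "Suc n"] U_period[of "Suc (Suc n)"] by (auto simp: M_def algebra_simps simp del: chebS.simps)

lemma degree_G_less: "degree (G (Suc n)) < N + 1"
  using N_eq by (simp add: degree_G del: chebS.simps)

lemma degree_x_G_less: "degree (x * G (Suc n)) < N + 2"
  using degree_x_mult_le[of "G (Suc n)"] degree_G_less by simp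

text \<open>The window ends with $M, M + 1$.  Its first $k$ members have the residues of block $n$, and
$U_{M+1}$ can be replaced by $x U_M$ because $U_{M-1}$ also lies in the window.\<close>

lemma hankel_residue_0:
  assumes "k \<ge> 1" "r = 0"
  shows "hankel = (- 1) ^ ((Suc k choose 2) * n) * (coeff (G (Suc n)) 0)\<^sup>2"
proof -
  let ?us = "map U [Suc N..<M]"
  let ?hs = "[G (Suc n), x * G (Suc n)] @ square_multiples"
  have N: "Suc k * n = N" "N + Suc k = M" using assms N_eq M_eq by auto
  obtain m where m: "M = Suc m" "Suc N \<le> m" using assms M_eq by (cases M) auto
  have "[Suc N..<N + k + 3] = [Suc N..<M] @ [M, Suc M]"
    using assms M_eq by (intro nth_equalityI) (auto simp: nth_append nth_Cons' simp del: upt_Suc)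
  hence "hankel = coeff_det ((weight_multiples @ ?us @ [U M]) @ U (Suc M) # [])"
    by (simp add: hankel_eq del: upt_Suc chebS.simps)
  also have "\<dots> = coeff_det ((weight_multiples @ ?us @ [U M]) @ (x * U M) # [])"
    unfolding m U_neighbours[of m]
  proof (intro coeff_det_add_span poly_module.span_add poly_module.span_scale poly_module.span_base)
    show "U m \<in> set ((weight_multiples @ map U [Suc N..<Suc m] @ [U (Suc m)]) @ [])" using m by auto
  qed auto
  also have "\<dots> = coeff_det (weight_multiples @ (?us @ [U M, x * U M]))" by simp
  also have "\<dots> = (- 1) ^ (N * (k + 2)) * coeff_det ((?us @ [U M, x * U M]) @ weight_multiples)"
    using assms by (subst coeff_det_swap) (simp add: M_eq del: chebS.simps)
  also have "(- 1 :: 'a) ^ (N * (k + 2)) = 1" using assms N_eq by (intro neg_one_even_power) auto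
  also have "(?us @ [U M, x * U M]) @ weight_multiples = map U [Suc k * n + 1..<Suc k * n + Suc k] @ map ((*) (U (Suc k))) ?hs"
    unfolding N by (simp add: U_M(1) weight_multiples_eq mult_ac del: chebS.simps upt_Suc)
  also have "coeff_det \<dots> = (- 1) ^ ((Suc k choose 2) * n) * coeff_det ?hs"
    using degree_G_less degree_x_G_less
    by (intro coeff_det_chebS_window, unfold N) (auto dest: degree_square_multiples simp del: chebS.simps)
  also have "coeff_det ?hs = (coeff (G (Suc n)) 0)\<^sup>2"
    unfolding square_multiples_def using degree_G_less degree_x_G_less
    by (subst coeff_det_mod_square) (auto simp: coeff_x_mult power2_eq_square simp del: chebS.simps)
  finally show ?thesis by simp
qed

text \<open>The mirror image of the case $r = 0$: the window starts with $M - 1, M$, the member $U_{M-1}$ is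
replaced by $x U_M$, and the other $k$ members have the residues of block $n + 1$.\<close>

lemma hankel_residue_pred:
  assumes "k \<ge> 1" "r = k - 1"
  shows "hankel = - ((- 1) ^ ((Suc k choose 2) * Suc n) * (coeff (G (Suc n)) 0)\<^sup>2)"
proof -
  let ?us = "map U [Suc M..<M + Suc k]"
  let ?hs = "square_multiples @ [x * G (Suc n), G (Suc n)]"
  have M: "M = N + 2" using assms M_eq by simp
  have "[Suc N..<N + k + 3] = Suc N # M # [Suc M..<M + Suc k]"
    using M by (intro nth_equalityI) (auto simp: nth_append nth_Cons' simp del: upt_Suc)
  hence "hankel = coeff_det (weight_multiples @ U (Suc N) # (U M # ?us))"
    by (simp add: hankel_eq del: upt_Suc chebS.simps)
  also have "U (Suc N) = x * U M + (smult (- 1) (U (Suc M)) + smult (- c) (U M))"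
    unfolding M by (simp add: monom_altdef)
  also have "coeff_det (weight_multiples @ \<dots> # (U M # ?us)) = coeff_det (weight_multiples @ (x * U M) # (U M # ?us))"
  proof (intro coeff_det_add_span poly_module.span_add poly_module.span_scale poly_module.span_base)
    show "U (Suc M) \<in> set (weight_multiples @ U M # ?us)"
    proof -
      have "U (Suc M) \<in> set ?us"
        unfolding set_map set_upt using assms by (intro imageI) simp
      thus ?thesis by (simp del: upt_Suc chebS.simps)
    qed
  qed auto
  also have "\<dots> = coeff_det ((weight_multiples @ [x * U M, U M]) @ ?us)" by simp
  also have "\<dots> = (- 1) ^ ((N + 2) * k) * coeff_det (?us @ (weight_multiples @ [x * U M, U M]))"
    by (subst coeff_det_swap) (simp del: chebS.simps upt_Suc)
  also have "(- 1 :: 'a) ^ ((N + 2) * k) = 1"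
    unfolding M[symmetric] M_def by (intro neg_one_even_power) auto
  also have "?us @ (weight_multiples @ [x * U M, U M])
      = map U [Suc k * Suc n + 1..<Suc k * Suc n + Suc k] @ map ((*) (U (Suc k))) ?hs"
    unfolding M_def[symmetric] by (simp add: U_M(1) weight_multiples_eq mult_ac del: chebS.simps upt_Suc)
  also have "coeff_det \<dots> = (- 1) ^ ((Suc k choose 2) * Suc n) * coeff_det ?hs"
    using M M_def degree_G_less degree_x_G_less
    by (intro coeff_det_chebS_window) (auto dest: degree_square_multiples simp del: chebS.simps)
  also have "coeff_det ?hs = coeff_det ([x * G (Suc n), G (Suc n)] @ square_multiples)"
    by (subst coeff_det_swap) (simp del: chebS.simps)
  also have "\<dots> = - ((coeff (G (Suc n)) 0)\<^sup>2)"
    unfolding square_multiples_def using degree_G_less degree_x_G_less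
    by (subst coeff_det_mod_square) (auto simp: coeff_x_mult power2_eq_square simp del: chebS.simps)
  finally show ?thesis by simp
qed

text \<open>The window starts with $M$ and ends with the next multiple $M + k + 1$ of $k + 1$.  The cofactors
$G_{n+1}$ and $G_{n+2}$ contribute the value of their Wronskian at $0$.\<close>

lemma hankel_residue_k:
  assumes "r = k"
  shows "hankel = (- 1) ^ ((Suc k choose 2) * Suc n)
    * (of_nat (Suc k) * chebS (- c) (Suc k) * (\<Sum>j = 1..Suc n. (coeff (G j) 0)\<^sup>2))"
proof -
  let ?us = "map U [Suc M..<M + Suc k]"
  let ?f = "G (Suc n)" and ?g = "G (Suc (Suc n))"
  let ?hs = "[?g] @ square_multiples @ [?f]"
  have M: "M = N + 1" using assms M_eq by simp
  hence le: "Suc k * Suc n \<le> N + 2" by (simp only: M_def)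
  have deg_g: "degree ?g < N + 2" using M M_def by (simp add: degree_G del: chebS.simps)
  have "[Suc N..<N + k + 3] = M # [Suc M..<M + Suc k] @ [M + Suc k]"
    using M by (intro nth_equalityI) (auto simp: nth_append nth_Cons' simp del: upt_Suc)
  hence "hankel = coeff_det ((weight_multiples @ [U M]) @ (?us @ [U (M + Suc k)]))"
    by (simp add: hankel_eq del: upt_Suc chebS.simps)
  also have "\<dots> = (- 1) ^ ((N + 1) * (k + 1)) * coeff_det ((?us @ [U (M + Suc k)]) @ (weight_multiples @ [U M]))"
    by (subst coeff_det_swap) (simp del: chebS.simps upt_Suc)
  also have "(?us @ [U (M + Suc k)]) @ (weight_multiples @ [U M])
      = map U [Suc k * Suc n + 1..<Suc k * Suc n + Suc k] @ map ((*) (U (Suc k))) ?hs"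
    unfolding M_def[symmetric] U_M(2) by (simp add: U_M(1) weight_multiples_eq del: chebS.simps upt_Suc)
  also have "coeff_det \<dots> = (- 1) ^ ((Suc k choose 2) * Suc n) * coeff_det ?hs"
    using le degree_G_less deg_g
    by (intro coeff_det_chebS_window) (auto dest: degree_square_multiples simp del: chebS.simps mult_Suc mult_Suc_right)
  also have "coeff_det ?hs = (- 1) ^ (N + 1) * coeff_det ([?f] @ ([?g] @ square_multiples))"
    using coeff_det_swap[of "[?g] @ square_multiples" "[?f]"] by (simp del: chebS.simps)
  also have "coeff_det ([?f] @ ([?g] @ square_multiples)) = coeff ?f 0 * coeff ?g 1 - coeff ?f 1 * coeff ?g 0"
    unfolding square_multiples_def using degree_G_less deg_g coeff_det_mod_square[of ?f N ?g] by simp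
  also have "\<dots> = poly (?f * pderiv ?g - pderiv ?f * ?g) 0"
    by (simp add: poly_0_coeff_0 coeff_mult coeff_pderiv mult.commute del: chebS.simps)
  also have "?f * pderiv ?g - pderiv ?f * ?g
      = of_nat (Suc k) * U (Suc k) * (\<Sum>j = 1..Suc n. (G j)\<^sup>2)"
    unfolding chebS_wronskian pderiv_chebV by (simp add: pderiv_pCons del: chebS.simps)
  also have "poly \<dots> 0 = of_nat (Suc k) * chebS (- c) (Suc k) * (\<Sum>j = 1..Suc n. (coeff (G j) 0)\<^sup>2)"
    by (simp add: poly_sum poly_chebS poly_0_coeff_0[symmetric] del: chebS.simps sum.cl_ivl_Suc)
  \<comment> \<open>The two rotations of the list give $(N+1)(k+1) + (N+1)$ sign changes, an even number because $k + 1$ divides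
    $N + 1$.\<close>
  also have "(- 1) ^ ((N + 1) * (k + 1)) * ((- 1) ^ ((Suc k choose 2) * Suc n) * ((- 1) ^ (N + 1) * y))
      = (- 1) ^ ((Suc k choose 2) * Suc n) * y" for y :: 'a
  proof -
    have "(- 1 :: 'a) ^ ((N + 1) * (k + 1)) * (- 1) ^ (N + 1) = (- 1) ^ ((N + 1) * (k + 2))"
      by (simp add: add_ac flip: power_add)
    also have "(N + 1) * (k + 2) = Suc n * (Suc k * Suc (Suc k))"
      unfolding M[symmetric] M_def by (simp only: mult_ac add_2_eq_Suc')
    also have "(- 1 :: 'a) ^ \<dots> = 1" by (intro neg_one_even_power) auto
    finally have even: "(- 1 :: 'a) ^ ((N + 1) * (k + 1)) * (- 1) ^ (N + 1) = 1" .
    have "a * (b * (d * y)) = (a * d) * (b * y)" for a b d :: 'a by (simp only: mult_ac)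
    thus ?thesis using even by (simp only: mult_1_left)
  qed
  finally show ?thesis .
qed

text \<open>The relation $U_{M+2} + U_{M-2} = ((x - c)^2 - 2) U_M$ has the leading term $x^2 U_M = q G_{n+1}$,
and the degree of $G_{n+1}$ is below $N$ because $r \geq 1$.  So it is a linear relation between
the rows.\<close>

lemma hankel_eq_0:
  assumes "1 \<le> r" "r + 2 \<le> k"
  shows "hankel = 0"
proof -
  let ?as = "weight_multiples @ map U [Suc N..<M + 2]" and ?bs = "map U [M + 3..<N + k + 3]"
  let ?span = "poly_module.span (set (?as @ ?bs))"
  have M: "N + 3 \<le> M" "M + 2 < N + k + 3" using assms M_eq by auto
  then obtain m where m: "M = Suc (Suc m)" by (cases M; cases "M - 1") auto
  have "[Suc N..<N + k + 3] = [Suc N..<M + 2] @ (M + 2) # [M + 3..<N + k + 3]"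
    using M by (intro nth_equalityI) (auto simp: nth_append nth_Cons' simp del: upt_Suc)
  hence "hankel = coeff_det (?as @ U (M + 2) # ?bs)"
    by (simp add: hankel_eq del: upt_Suc chebS.simps)
  also have "\<dots> = 0"
  proof (rule coeff_det_span_eq_0)
    \<comment> \<open>The square of $x - c$ expands as $x^2 - 2c(x - c) - c^2$, and $(x - c) U_M = U_{M+1} + U_{M-1}$.\<close>
    have eq: "U (M + 2) = x2 * U (Suc k) * G (Suc n) + (smult (- 2 * c) (U (Suc M)) + (smult (- 2 * c) (U (Suc m))
        + (smult (- (c\<^sup>2 + 2)) (U M) + smult (- 1) (U m))))"
    proof -
      let ?d = "[:c:]"
      have t: "[:- c, 1:] = x - ?d" and x2: "x2 = x * x"
        by (simp_all add: monom_altdef mult_monom numeral_2_eq_2)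
      have sm: "smult (- 2 * c) p = - 2 * ?d * p" "smult (- (c\<^sup>2 + 2)) p = - (?d * ?d + 2) * p" for p
        by (simp_all add: numeral_poly algebra_simps power2_eq_square smult_add_left smult_diff_left)
      have "x2 * U (Suc k) * G (Suc n) = x * x * U M" by (simp add: U_M x2 mult_ac del: chebS.simps)
      moreover have "chebS t (Suc (Suc (Suc (Suc m)))) = y * y * chebS t (Suc (Suc m))
          + (- 2 * d * chebS t (Suc (Suc (Suc m))) + (- 2 * d * chebS t (Suc m)
          + (- (d * d + 2) * chebS t (Suc (Suc m)) + - chebS t m)))" if "t = y - d" for t y d :: "'a poly"
        unfolding chebS.simps(3) that by (simp add: algebra_simps)
      ultimately show ?thesis unfolding sm m using t by (simp del: chebS.simps)
    qed
    have "degree (G (Suc n)) < N"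
      using N_eq assms by (simp add: degree_G del: chebS.simps)
    hence "x2 * U (Suc k) * G (Suc n) \<in> poly_module.span (set weight_multiples)"
      using mult_in_span[of "G (Suc n)" N "x2 * U (Suc k)"]
      by (simp add: weight_multiples_def atLeast0LessThan del: chebS.simps)
    hence "x2 * U (Suc k) * G (Suc n) \<in> ?span"
      by (rule rev_subsetD) (intro poly_module.span_mono, auto)
    moreover have "U j \<in> ?span" if "j \<in> {m, Suc m, M, Suc M}" for j
      using that M m by (intro poly_module.span_base) auto
    ultimately show "U (M + 2) \<in> ?span" unfolding eq
      by (intro poly_module.span_add poly_module.span_scale) auto
  qed
  finally show ?thesis .
qed

end

lemma F_quot_eq:
  assumes "l > 0"
  shows "F_quot (l * j) l = to_fract (chebS (chebV indet l) j)"
proof -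
  have "F l \<noteq> 0" using monic_chebS_linear[of l "0 :: int"] assms by (auto simp: F_eq_chebS)
  thus ?thesis by (simp add: F_quot_def F_eq_chebS chebS_mult)
qed

text \<open>At $x = 0$ the argument $x - c$ is $-c$; the square removes the sign that comes from parity.\<close>

lemma coeff_chebS_chebV_0_square: "(coeff (chebS (chebV [:- c, 1:] l) j) 0)\<^sup>2 = (chebS (chebV c l) j)\<^sup>2"
  by (simp add: poly_chebS poly_chebV chebS_chebV_uminus_square flip: poly_0_coeff_0)

text \<open>The theorem over the integral polynomials, with the quotients of the statement replaced by the
polynomials $S_j(V_{k+1})$.  What is left to do is the comparison of signs.\<close>

lemma hankel_det_cases:
  fixes k n r N :: nat
  defines "g \<equiv> chebS (chebV indet (k + 1))"
  assumes "r \<le> k" "N = (k + 1) * n + r"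
  shows "k \<ge> 1 \<Longrightarrow> r = 0 \<Longrightarrow> hankel_det k N = (- 1) ^ (((k + 1) choose 2) * n) * (g (n + 1))\<^sup>2"
    and "k \<ge> 1 \<Longrightarrow> r = k - 1 \<Longrightarrow>
      hankel_det k N = (- 1) ^ (((k + 1) choose 2) * n + ((k - 1) choose 2)) * (g (n + 1))\<^sup>2"
    and "r = k \<Longrightarrow> hankel_det k N = (- 1) ^ (((k + 1) choose 2) * n + (k choose 2))
      * of_nat (k + 1) * F (k + 1) * (\<Sum>j = 1..n + 1. (g j)\<^sup>2)"
    and "r \<noteq> 0 \<Longrightarrow> r \<noteq> k - 1 \<Longrightarrow> r \<noteq> k \<Longrightarrow> hankel_det k N = 0"
proof -
  interpret hankel_window indet k n r N using assms by unfold_locales auto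
  have hankel: "hankel_det k N = hankel" by (simp add: hankel_det_def hankel_def)
  show "hankel_det k N = (- 1) ^ (((k + 1) choose 2) * n) * (g (n + 1))\<^sup>2" if "k \<ge> 1" "r = 0"
    using hankel_residue_0[OF that] unfolding hankel coeff_chebS_chebV_0_square by (simp add: g_def del: chebS.simps)
  show "hankel_det k N = (- 1) ^ (((k + 1) choose 2) * n + ((k - 1) choose 2)) * (g (n + 1))\<^sup>2"
    if "k \<ge> 1" "r = k - 1"
  proof -
    from \<open>k \<ge> 1\<close> obtain m where m: "k = Suc m" by (cases k) auto
    \<comment> \<open>The difference of the two binomial coefficients is the odd number $2k - 1$.\<close>
    have "(- 1 :: int poly) ^ (Suc k choose 2) = - ((- 1) ^ ((k - 1) choose 2))"
      unfolding m minus_one_power_choose_Suc by (cases "even m") auto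
    thus ?thesis using hankel_residue_pred[OF that] unfolding hankel coeff_chebS_chebV_0_square
      by (simp add: g_def power_add mult_ac del: chebS.simps)
  qed
  show "hankel_det k N = (- 1) ^ (((k + 1) choose 2) * n + (k choose 2))
      * of_nat (k + 1) * F (k + 1) * (\<Sum>j = 1..n + 1. (g j)\<^sup>2)" if "r = k"
  proof -
    have "(- 1) ^ (Suc k choose 2) * chebS (- indet) (Suc k) = (- 1) ^ (k choose 2) * F (Suc k)"
      unfolding chebS_uminus minus_one_power_choose_Suc F_eq_chebS by (cases "even k") auto
    hence eq: "(- 1) ^ ((Suc k choose 2) * n) * ((- 1) ^ (Suc k choose 2) * chebS (- indet) (Suc k)) * y
        = (- 1) ^ ((Suc k choose 2) * n) * ((- 1) ^ (k choose 2) * F (Suc k)) * y" for y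
      by (simp only:)
    have sign: "(- 1 :: int poly) ^ ((Suc k choose 2) * Suc n)
        = (- 1) ^ ((Suc k choose 2) * n) * (- 1) ^ (Suc k choose 2)"
      unfolding mult_Suc_right power_add by (rule mult.commute)
    have "hankel = (- 1) ^ ((Suc k choose 2) * n) * ((- 1) ^ (Suc k choose 2) * chebS (- indet) (Suc k))
        * (of_nat (Suc k) * (\<Sum>j = 1..Suc n. (g j)\<^sup>2))"
      unfolding hankel_residue_k[OF that] coeff_chebS_chebV_0_square sign
      by (simp only: mult_ac g_def Suc_eq_plus1)
    also note eq
    finally show ?thesis unfolding hankel
      by (simp only: power_add mult_ac Suc_eq_plus1)
  qed
  show "hankel_det k N = 0" if "r \<noteq> 0" "r \<noteq> k - 1" "r \<noteq> k"
    unfolding hankel using that r_le by (intro hankel_eq_0) auto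
qed

theorem theorem1p3:
  shows "(\<forall>k n r N :: nat. k \<ge> 1 \<longrightarrow> r \<le> k \<longrightarrow> N = (k + 1) * n + r \<longrightarrow>
      (r = 0 \<longrightarrow> to_fract (hankel_det k N) =
         (-1) ^ (((k + 1) choose 2) * n) * (F_quot ((k + 1) * (n + 1)) (k + 1)) ^ 2) \<and>
      (r = k - 1 \<longrightarrow> to_fract (hankel_det k N) =
         (-1) ^ (((k + 1) choose 2) * n + ((k - 1) choose 2))
           * (F_quot ((k + 1) * (n + 1)) (k + 1)) ^ 2) \<and>
      (r = k \<longrightarrow> to_fract (hankel_det k N) =
         (-1) ^ (((k + 1) choose 2) * n + (k choose 2)) * of_nat (k + 1) * to_fract (F (k + 1))
           * (\<Sum>j = 1..n + 1. (F_quot ((k + 1) * j) (k + 1)) ^ 2)) \<and>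
      (r \<noteq> 0 \<and> r \<noteq> k - 1 \<and> r \<noteq> k \<longrightarrow> to_fract (hankel_det k N) = 0)) \<and>
    (\<forall>n :: nat. hankel_det 0 n = (\<Sum>j = 1..n + 1. (F j) ^ 2))"
proof (intro conjI allI impI)
  interpret to_fract: inj_comm_ring_hom "to_fract :: int poly \<Rightarrow> int poly fract"
    by unfold_locales auto
  note hom = to_fract.hom_mult to_fract.hom_power to_fract.hom_sum to_fract.hom_uminus
    to_fract.hom_one to_fract.hom_of_nat to_fract.hom_zero
  fix k n r N :: nat
  have quot: "F_quot ((k + 1) * j) (k + 1) = to_fract (chebS (chebV indet (k + 1)) j)" for j
    by (rule F_quot_eq) simp
  assume k: "k \<ge> 1" and r: "r \<le> k" "N = (k + 1) * n + r"
  note cases = hankel_det_cases[OF r]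
  show "to_fract (hankel_det k N) =
      (-1) ^ (((k + 1) choose 2) * n) * (F_quot ((k + 1) * (n + 1)) (k + 1)) ^ 2" if "r = 0"
    unfolding cases(1)[OF k that] quot by (simp only: hom)
  show "to_fract (hankel_det k N) =
      (-1) ^ (((k + 1) choose 2) * n + ((k - 1) choose 2))
        * (F_quot ((k + 1) * (n + 1)) (k + 1)) ^ 2" if "r = k - 1"
    unfolding cases(2)[OF k that] quot by (simp only: hom)
  show "to_fract (hankel_det k N) =
      (-1) ^ (((k + 1) choose 2) * n + (k choose 2)) * of_nat (k + 1) * to_fract (F (k + 1))
        * (\<Sum>j = 1..n + 1. (F_quot ((k + 1) * j) (k + 1)) ^ 2)" if "r = k"
    unfolding cases(3)[OF that] quot by (simp only: hom)
  show "to_fract (hankel_det k N) = 0" if "r \<noteq> 0 \<and> r \<noteq> k - 1 \<and> r \<noteq> k"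
    using cases(4) that by simp
next
  fix n :: nat
  show "hankel_det 0 n = (\<Sum>j = 1..n + 1. (F j) ^ 2)"
    using hankel_det_cases(3)[of 0 0 n n] by (simp add: F_eq_chebS numeral_2_eq_2)
qed

end
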